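(* Let $n$ be a positive integer and let $\phi : G_{n,p}^{2}\to G_{n,d}^{2}$ be the group homomorphism defined on generators, for $i<j$, by $\phi(a_{ij}^{0})=a_{ij}$ and $\phi(a_{ij}^{1})=\tau_{i}a_{ij}\tau_{i}$. If two elements of $G_{n,p}^{2}$ are equivalent in $G_{n,d}^{2}$ (that is, their images under $\phi$ are equal in $G_{n,d}^{2}$), then they are equal in $G_{n,p}^{2}$. In other words, $\phi$ is a monomorphism.
   Context: Convention: generators are indexed by unordered pairs, so $a_{ji}$ means $a_{ij}$ and $a_{ji}^{\epsilon}$ means $a_{ij}^{\epsilon}$; the superscript $\epsilon\in\{0,1\}$ in $a_{ij}^{\epsilon}$ is a label, not a power. $G_{n,p}^{2}$ ($G_n^2$ with parity) is the group with generators $a_{ij}^{\epsilon}$ for $\{i,j\}\subset\{1,\dots,n\}$, $i<j$, $\epsilon\in\{0,1\}$, and relations: (1) $(a_{ij}^{\epsilon})^{2}=1$ for all $i\ne j$ and $\epsilon\in\{0,1\}$; (2) $a_{ij}^{\epsilon_{ij}}a_{kl}^{\epsilon_{kl}}=a_{kl}^{\epsilon_{kl}}a_{ij}^{\epsilon_{ij}}$ for distinct $i,j,k,l$ and all $\epsilon_{ij},\epsilon_{kl}\in\{0,1\}$; (3) $a_{ij}^{\epsilon_{ij}}a_{ik}^{\epsilon_{ik}}a_{jk}^{\epsilon_{jk}}=a_{jk}^{\epsilon_{jk}}a_{ik}^{\epsilon_{ik}}a_{ij}^{\epsilon_{ij}}$ for distinct $i,j,k$ and all $\epsilon_{ij},\epsilon_{ik},\epsilon_{jk}\in\{0,1\}$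 with $\epsilon_{ij}+\epsilon_{ik}+\epsilon_{jk}\equiv 0 \pmod 2$. $G_{n,d}^{2}$ ($G_n^2$ with points) is the group with generators $a_{ij}$ for $\{i,j\}\subset\{1,\dots,n\}$, $i<j$, and $\tau_{i}$ for $i\in\{1,\dots,n\}$, and relations: (1) $a_{ij}^{2}=1$ for $i\neq j$; (2) $a_{ij}a_{kl}=a_{kl}a_{ij}$ for distinct $i,j,k,l$; (3) $a_{ij}a_{ik}a_{jk}=a_{jk}a_{ik}a_{ij}$ for distinct $i,j,k$; (4) $\tau_{i}^{2}=1$ for all $i$; (5) $\tau_{i}\tau_{j}=\tau_{j}\tau_{i}$ for all $i,j$; (6) $\tau_{i}\tau_{j}a_{ij}\tau_{j}\tau_{i}=a_{ij}$ for distinct $i,j$; (7) $a_{ij}\tau_{k}=\tau_{k}a_{ij}$ for distinct $i,j,k$. *)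

theory Defs
  imports "HOL-Algebra.Group"
begin

text \<open>
  A letter \<open>(x, False)\<close> stands for the generator \<open>x\<close> and \<open>(x, True)\<close> for its formal inverse.
  A relation \<open>u = v\<close> is the pair \<open>(u, v)\<close> of words.
\<close>

type_synonym 'g word = "('g \<times> bool) list"

definition words :: "'g set \<Rightarrow> 'g word set" where
  "words S = lists (S \<times> UNIV)"

definition pos :: "'g list \<Rightarrow> 'g word" where
  "pos xs = map (\<lambda>x. (x, False)) xs"

inductive_set pres_rel :: "'g set \<Rightarrow> ('g word \<times> 'g word) set \<Rightarrow> ('g word \<times> 'g word) set"
  for S :: "'g set" and R :: "('g word \<times> 'g word) set" where
  refl: "w \<in> words S \<Longrightarrow> (w, w) \<in> pres_rel S R"
| sym: "(u, v) \<in> pres_rel S R \<Longrightarrow> (v, u) \<in> pres_rel S R"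
| trans: "(u, v) \<in> pres_rel S R \<Longrightarrow> (v, w) \<in> pres_rel S R \<Longrightarrow> (u, w) \<in> pres_rel S R"
| mult: "(u, v) \<in> pres_rel S R \<Longrightarrow> (u', v') \<in> pres_rel S R \<Longrightarrow> (u @ u', v @ v') \<in> pres_rel S R"
| cancel: "x \<in> S \<Longrightarrow> ([(x, b), (x, \<not> b)], []) \<in> pres_rel S R"
| rel: "(u, v) \<in> R \<Longrightarrow> u \<in> words S \<Longrightarrow> v \<in> words S \<Longrightarrow> (u, v) \<in> pres_rel S R"

definition presented_group :: "'g set \<Rightarrow> ('g word \<times> 'g word) set \<Rightarrow> 'g word set monoid" where
  "presented_group S R =
    \<lparr> carrier = words S // pres_rel S R,
      mult = (\<lambda>X Y. \<Union>u\<in>X. \<Union>v\<in>Y. pres_rel S R `` {u @ v}),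
      one = pres_rel S R `` {[]} \<rparr>"

definition pres_gen :: "'g set \<Rightarrow> ('g word \<times> 'g word) set \<Rightarrow> 'g \<Rightarrow> 'g word set" where
  "pres_gen S R x = pres_rel S R `` {[(x, False)]}"

lemma words_Nil [simp]: "[] \<in> words S"
  and words_Cons [simp]: "(x, b) # w \<in> words S \<longleftrightarrow> x \<in> S \<and> w \<in> words S"
  and words_append [simp]: "u @ v \<in> words S \<longleftrightarrow> u \<in> words S \<and> v \<in> words S"
  by (auto simp: words_def)

lemma pos_simps [simp]: "pos [] = []" "pos (x # xs) = (x, False) # pos xs"
  by (simp_all add: pos_def)

lemma pres_rel_words:
  assumes "(u, v) \<in> pres_rel S R"
  shows "u \<in> words S \<and> v \<in> words S"
  using assms by induction auto

lemma equiv_pres_rel: "equiv (words S) (pres_rel S R)"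
proof (rule equivI)
  show "pres_rel S R \<subseteq> words S \<times> words S"
    using pres_rel_words by auto
  show "refl_on (words S) (pres_rel S R)"
    by (auto simp: refl_on_def intro: pres_rel.refl)
  show "sym (pres_rel S R)"
    by (auto simp: sym_def intro: pres_rel.sym)
  show "trans (pres_rel S R)"
    by (auto intro!: transI intro: pres_rel.trans)
qed

lemma pres_class_eq_iff:
  assumes "u \<in> words S" "v \<in> words S"
  shows "pres_rel S R `` {u} = pres_rel S R `` {v} \<longleftrightarrow> (u, v) \<in> pres_rel S R"
  using eq_equiv_class_iff[OF equiv_pres_rel assms] .

lemma carrier_presented_group [simp]:
  "carrier (presented_group S R) = words S // pres_rel S R"
  by (simp add: presented_group_def)

lemma one_presented_group: "\<one>\<^bsub>presented_group S R\<^esub> = pres_rel S R `` {[]}"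
  by (simp add: presented_group_def)

lemma mult_presented_group:
  assumes "u \<in> words S" "v \<in> words S"
  shows "(pres_rel S R `` {u}) \<otimes>\<^bsub>presented_group S R\<^esub> (pres_rel S R `` {v})
    = pres_rel S R `` {u @ v}"
proof -
  have "congruent2 (pres_rel S R) (pres_rel S R) (\<lambda>u v. pres_rel S R `` {u @ v})"
  proof (rule congruent2I')
    fix y1 z1 y2 z2
    assume a: "(y1, z1) \<in> pres_rel S R" "(y2, z2) \<in> pres_rel S R"
    then have "(y1 @ y2, z1 @ z2) \<in> pres_rel S R"
      by (rule pres_rel.mult)
    then show "pres_rel S R `` {y1 @ y2} = pres_rel S R `` {z1 @ z2}"
      by (rule equiv_class_eq[OF equiv_pres_rel])
  qed
  from UN_equiv_class2[OF equiv_pres_rel equiv_pres_rel this assms]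
  show ?thesis by (simp add: presented_group_def)
qed

definition word_inv :: "'g word \<Rightarrow> 'g word" where
  "word_inv w = rev (map (\<lambda>(x, b). (x, \<not> b)) w)"

lemma word_inv_words: "w \<in> words S \<Longrightarrow> word_inv w \<in> words S"
  by (auto simp: word_inv_def words_def)

lemma word_inv_cancel:
  assumes "w \<in> words S"
  shows "(word_inv w @ w, []) \<in> pres_rel S R"
  using assms
proof (induction w)
  case Nil
  then show ?case by (auto simp: word_inv_def intro: pres_rel.refl)
next
  case (Cons a w)
  obtain x b where a: "a = (x, b)" by (cases a)
  have x: "x \<in> S" and w: "w \<in> words S" using Cons.prems a by auto
  have "([(x, \<not> b), (x, b)], []) \<in> pres_rel S R"
    using pres_rel.cancel[OF x, of "\<not> b"] by simp
  from pres_rel.mult[OF this pres_rel.refl[OF w]]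
  have "([(x, \<not> b), (x, b)] @ w, [] @ w) \<in> pres_rel S R" .
  from pres_rel.mult[OF pres_rel.refl[OF word_inv_words[OF w]] this]
  have "(word_inv (a # w) @ a # w, word_inv w @ w) \<in> pres_rel S R"
    by (simp add: word_inv_def a)
  then show ?case using Cons.IH[OF w] by (rule pres_rel.trans)
qed

theorem group_presented_group: "group (presented_group S R)"
proof (rule groupI)
  fix x y z
  assume "x \<in> carrier (presented_group S R)" "y \<in> carrier (presented_group S R)"
    "z \<in> carrier (presented_group S R)"
  then show "x \<otimes>\<^bsub>presented_group S R\<^esub> y \<otimes>\<^bsub>presented_group S R\<^esub> z
    = x \<otimes>\<^bsub>presented_group S R\<^esub> (y \<otimes>\<^bsub>presented_group S R\<^esub> z)"
    by (auto elim!: quotientE simp: mult_presented_group)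
next
  fix x
  assume "x \<in> carrier (presented_group S R)"
  then obtain w where w: "w \<in> words S" "x = pres_rel S R `` {w}"
    by (auto elim: quotientE)
  have "pres_rel S R `` {word_inv w} \<otimes>\<^bsub>presented_group S R\<^esub> x = \<one>\<^bsub>presented_group S R\<^esub>"
    using w by (simp add: mult_presented_group word_inv_words one_presented_group
        pres_class_eq_iff word_inv_cancel)
  then show "\<exists>y\<in>carrier (presented_group S R). y \<otimes>\<^bsub>presented_group S R\<^esub> x
      = \<one>\<^bsub>presented_group S R\<^esub>"
    using w word_inv_words by (auto intro!: bexI[of _ "pres_rel S R `` {word_inv w}"] quotientI)
qed (auto elim!: quotientE simp: mult_presented_group one_presented_group intro!: quotientI)

lemma pres_gen_closed:
  assumes "x \<in> S" shows "pres_gen S R x \<in> carrier (presented_group S R)"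
  using assms by (auto simp: pres_gen_def intro!: quotientI)

fun word_val :: "('a, 'm) monoid_scheme \<Rightarrow> ('g \<Rightarrow> 'a) \<Rightarrow> 'g word \<Rightarrow> 'a" where
  "word_val H f [] = \<one>\<^bsub>H\<^esub>"
| "word_val H f ((x, b) # w) = (if b then inv\<^bsub>H\<^esub> (f x) else f x) \<otimes>\<^bsub>H\<^esub> word_val H f w"

lemma (in group) word_val_closed:
  assumes "f \<in> S \<rightarrow> carrier G" "w \<in> words S"
  shows "word_val G f w \<in> carrier G"
  using assms(2)
proof (induction w)
  case (Cons a w)
  then show ?case using assms(1) by (cases a) auto
qed auto

lemma (in group) word_val_append:
  assumes "f \<in> S \<rightarrow> carrier G" "u \<in> words S" "v \<in> words S"
  shows "word_val G f (u @ v) = word_val G f u \<otimes> word_val G f v"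
  using assms(2)
proof (induction u)
  case (Cons a u)
  then show ?case using assms word_val_closed[OF assms(1)]
    by (cases a) (auto simp: m_assoc Pi_iff)
next
  case Nil
  then show ?case using word_val_closed[OF assms(1,3)] by simp
qed

lemma (in group) word_val_cong:
  assumes f: "f \<in> S \<rightarrow> carrier G"
    and R: "\<And>u v. (u, v) \<in> R \<Longrightarrow> word_val G f u = word_val G f v"
    and "(u, v) \<in> pres_rel S R"
  shows "word_val G f u = word_val G f v"
  using assms(3)
proof induction
  case (mult u v u' v')
  then show ?case
    using pres_rel_words[OF mult.hyps(1)] pres_rel_words[OF mult.hyps(2)]
    by (simp add: word_val_append[OF f])
next
  case (cancel x b)
  then have "f x \<in> carrier G" using f by auto
  then show ?case by simp
qed (auto intro: R)

theorem (in group) presented_group_lift: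
  assumes f: "f \<in> S \<rightarrow> carrier G"
    and R: "\<And>u v. (u, v) \<in> R \<Longrightarrow> word_val G f u = word_val G f v"
  shows "\<exists>h\<in>hom (presented_group S R) G. \<forall>x\<in>S. h (pres_gen S R x) = f x"
proof -
  define h where "h X = word_val G f (SOME w. w \<in> X)" for X
  have h: "h (pres_rel S R `` {w}) = word_val G f w" if "w \<in> words S" for w
  proof -
    have "w \<in> pres_rel S R `` {w}" using that by (auto intro: pres_rel.refl)
    then have "(SOME w'. w' \<in> pres_rel S R `` {w}) \<in> pres_rel S R `` {w}" by (rule someI)
    then have "(w, SOME w'. w' \<in> pres_rel S R `` {w}) \<in> pres_rel S R" by simp
    from word_val_cong[OF f R this] show ?thesis by (simp add: h_def)
  qed
  have "h \<in> hom (presented_group S R) G"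
    by (rule homI) (auto elim!: quotientE simp: mult_presented_group h word_val_append[OF f]
        intro: word_val_closed[OF f])
  moreover have "h (pres_gen S R x) = f x" if "x \<in> S" for x
  proof -
    have "f x \<in> carrier G" using f that by auto
    then show ?thesis using that by (simp add: pres_gen_def h)
  qed
  ultimately show ?thesis by blast
qed

lemma pres_gen_relation:
  assumes "(pos xs, pos ys) \<in> R" "set xs \<subseteq> S" "set ys \<subseteq> S"
  shows "foldr (\<otimes>\<^bsub>presented_group S R\<^esub>) (map (pres_gen S R) xs) \<one>\<^bsub>presented_group S R\<^esub>
    = foldr (\<otimes>\<^bsub>presented_group S R\<^esub>) (map (pres_gen S R) ys) \<one>\<^bsub>presented_group S R\<^esub>"
proof -
  have w: "pos zs \<in> words S" if "set zs \<subseteq> S" for zs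
    using that by (induction zs) auto
  have "foldr (\<otimes>\<^bsub>presented_group S R\<^esub>) (map (pres_gen S R) zs) \<one>\<^bsub>presented_group S R\<^esub>
      = pres_rel S R `` {pos zs}" if "set zs \<subseteq> S" for zs
    using that
    by (induction zs) (auto simp: one_presented_group pres_gen_def mult_presented_group w)
  with assms show ?thesis by (simp add: pres_class_eq_iff w pres_rel.rel)
qed

text \<open>
  \<open>G_parity n\<close> is \<open>G\<^sub>n\<^sup>2\<close> with parity and \<open>G_points n\<close> is \<open>G\<^sub>n\<^sup>2\<close> with points.
  Generators carry the unordered pair \<open>{i, j}\<close>, so \<open>a\<^sub>i\<^sub>j\<close> and \<open>a\<^sub>j\<^sub>i\<close> are the same generator;
  the second argument of \<open>AP\<close> is the parity label, 0 or 1.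
\<close>

datatype parity_gen = AP "nat set" nat

definition parity_gens :: "nat \<Rightarrow> parity_gen set" where
  "parity_gens n = {AP {i, j} e |i j e. i \<in> {1..n} \<and> j \<in> {1..n} \<and> i < j \<and> e \<in> {0, 1}}"

definition parity_rels :: "nat \<Rightarrow> (parity_gen word \<times> parity_gen word) set" where
  "parity_rels n =
    {(pos [AP {i, j} e, AP {i, j} e], []) |i j e.
       {i, j} \<subseteq> {1..n} \<and> i \<noteq> j \<and> e \<in> {0, 1}} \<union>
    {(pos [AP {i, j} e, AP {k, l} e'], pos [AP {k, l} e', AP {i, j} e]) |i j k l e e'.
       {i, j, k, l} \<subseteq> {1..n} \<and> distinct [i, j, k, l] \<and> {e, e'} \<subseteq> {0, 1}} \<union>
    {(pos [AP {i, j} e, AP {i, k} e', AP {j, k} e''],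
      pos [AP {j, k} e'', AP {i, k} e', AP {i, j} e]) |i j k e e' e''.
       {i, j, k} \<subseteq> {1..n} \<and> distinct [i, j, k] \<and> {e, e', e''} \<subseteq> {0, 1} \<and> even (e + e' + e'')}"

definition G_parity :: "nat \<Rightarrow> parity_gen word set monoid" where
  "G_parity n = presented_group (parity_gens n) (parity_rels n)"

definition a_parity :: "nat \<Rightarrow> nat \<Rightarrow> nat \<Rightarrow> nat \<Rightarrow> parity_gen word set" where
  "a_parity n i j e = pres_gen (parity_gens n) (parity_rels n) (AP {i, j} e)"

datatype point_gen = AD "nat set" | TD nat

definition point_gens :: "nat \<Rightarrow> point_gen set" where
  "point_gens n = {AD {i, j} |i j. i \<in> {1..n} \<and> j \<in> {1..n} \<and> i < j} \<union> {TD i |i. i \<in> {1..n}}"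

definition point_rels :: "nat \<Rightarrow> (point_gen word \<times> point_gen word) set" where
  "point_rels n =
    {(pos [AD {i, j}, AD {i, j}], []) |i j. {i, j} \<subseteq> {1..n} \<and> i \<noteq> j} \<union>
    {(pos [AD {i, j}, AD {k, l}], pos [AD {k, l}, AD {i, j}]) |i j k l.
       {i, j, k, l} \<subseteq> {1..n} \<and> distinct [i, j, k, l]} \<union>
    {(pos [AD {i, j}, AD {i, k}, AD {j, k}], pos [AD {j, k}, AD {i, k}, AD {i, j}]) |i j k.
       {i, j, k} \<subseteq> {1..n} \<and> distinct [i, j, k]} \<union>
    {(pos [TD i, TD i], []) |i. i \<in> {1..n}} \<union>
    {(pos [TD i, TD j], pos [TD j, TD i]) |i j. {i, j} \<subseteq> {1..n}} \<union>
    {(pos [TD i, TD j, AD {i, j}, TD j, TD i], pos [AD {i, j}]) |i j.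
       {i, j} \<subseteq> {1..n} \<and> i \<noteq> j} \<union>
    {(pos [AD {i, j}, TD k], pos [TD k, AD {i, j}]) |i j k.
       {i, j, k} \<subseteq> {1..n} \<and> distinct [i, j, k]}"

definition G_points :: "nat \<Rightarrow> point_gen word set monoid" where
  "G_points n = presented_group (point_gens n) (point_rels n)"

definition a_points :: "nat \<Rightarrow> nat \<Rightarrow> nat \<Rightarrow> point_gen word set" where
  "a_points n i j = pres_gen (point_gens n) (point_rels n) (AD {i, j})"

definition tau_points :: "nat \<Rightarrow> nat \<Rightarrow> point_gen word set" where
  "tau_points n i = pres_gen (point_gens n) (point_rels n) (TD i)"

lemma group_G_parity: "group (G_parity n)"
  and group_G_points: "group (G_points n)"
  by (simp_all add: G_parity_def G_points_def group_presented_group)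

lemma AD_in_point_gens: "{i, j} \<subseteq> {1..n} \<Longrightarrow> i \<noteq> j \<Longrightarrow> AD {i, j} \<in> point_gens n"
proof (induction i j rule: linorder_wlog)
  case (le i j)
  then have "i \<in> {1..n} \<and> j \<in> {1..n} \<and> i < j" by auto
  then show ?case unfolding point_gens_def by blast
next
  case (sym i j)
  then show ?case by (simp add: insert_commute)
qed

lemma TD_in_point_gens: "i \<in> {1..n} \<Longrightarrow> TD i \<in> point_gens n"
  by (auto simp: point_gens_def)

lemma points_closed:
  shows "{i, j} \<subseteq> {1..n} \<Longrightarrow> i \<noteq> j \<Longrightarrow> a_points n i j \<in> carrier (G_points n)"
    and "i \<in> {1..n} \<Longrightarrow> tau_points n i \<in> carrier (G_points n)"
  unfolding a_points_def tau_points_def G_points_def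
  by (rule pres_gen_closed, erule (1) AD_in_point_gens)
    (rule pres_gen_closed, erule TD_in_point_gens)

lemma a_points_commute: "a_points n i j = a_points n j i"
  by (simp add: a_points_def insert_commute)

lemma points_relations:
  fixes n :: nat
  defines "G \<equiv> G_points n" and "a \<equiv> a_points n" and "t \<equiv> tau_points n"
  shows "{i, j} \<subseteq> {1..n} \<Longrightarrow> i \<noteq> j \<Longrightarrow> a i j \<otimes>\<^bsub>G\<^esub> a i j = \<one>\<^bsub>G\<^esub>"
    and "{i, j, k, l} \<subseteq> {1..n} \<Longrightarrow> distinct [i, j, k, l] \<Longrightarrow> a i j \<otimes>\<^bsub>G\<^esub> a k l = a k l \<otimes>\<^bsub>G\<^esub> a i j"
    and "{i, j, k} \<subseteq> {1..n} \<Longrightarrow> distinct [i, j, k] \<Longrightarrow>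
      a i j \<otimes>\<^bsub>G\<^esub> (a i k \<otimes>\<^bsub>G\<^esub> a j k) = a j k \<otimes>\<^bsub>G\<^esub> (a i k \<otimes>\<^bsub>G\<^esub> a i j)"
    and "i \<in> {1..n} \<Longrightarrow> t i \<otimes>\<^bsub>G\<^esub> t i = \<one>\<^bsub>G\<^esub>"
    and "{i, j} \<subseteq> {1..n} \<Longrightarrow> t i \<otimes>\<^bsub>G\<^esub> t j = t j \<otimes>\<^bsub>G\<^esub> t i"
    and "{i, j} \<subseteq> {1..n} \<Longrightarrow> i \<noteq> j \<Longrightarrow>
      t i \<otimes>\<^bsub>G\<^esub> (t j \<otimes>\<^bsub>G\<^esub> (a i j \<otimes>\<^bsub>G\<^esub> (t j \<otimes>\<^bsub>G\<^esub> t i))) = a i j"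
    and "{i, j, k} \<subseteq> {1..n} \<Longrightarrow> distinct [i, j, k] \<Longrightarrow> a i j \<otimes>\<^bsub>G\<^esub> t k = t k \<otimes>\<^bsub>G\<^esub> a i j"
proof -
  interpret group G unfolding G_def by (rule group_G_points)
  note R = pres_gen_relation[where S = "point_gens n" and R = "point_rels n",
      folded G_points_def, folded G_def]
  note cl = points_closed[where n = n, folded G_def, folded a_def t_def]
  note gs = AD_in_point_gens TD_in_point_gens
  note a_d = meta_eq_to_obj_eq[OF a_def, THEN fun_cong, THEN fun_cong, unfolded a_points_def]
  note t_d = meta_eq_to_obj_eq[OF t_def, THEN fun_cong, unfolded tau_points_def]
  show "a i j \<otimes>\<^bsub>G\<^esub> a i j = \<one>\<^bsub>G\<^esub>" if h: "{i, j} \<subseteq> {1..n}" "i \<noteq> j"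
  proof -
    have "(pos [AD {i, j}, AD {i, j}], pos []) \<in> point_rels n"
      using h unfolding point_rels_def pos_simps(1) by blast
    from R[OF this] show ?thesis using h cl(1)[OF h] gs by (simp flip: a_d t_d)
  qed
  show "a i j \<otimes>\<^bsub>G\<^esub> a k l = a k l \<otimes>\<^bsub>G\<^esub> a i j"
    if h: "{i, j, k, l} \<subseteq> {1..n}" "distinct [i, j, k, l]"
  proof -
    have "(pos [AD {i, j}, AD {k, l}], pos [AD {k, l}, AD {i, j}]) \<in> point_rels n"
      using h unfolding point_rels_def by blast
    from R[OF this] show ?thesis using h cl gs by (simp flip: a_d t_d)
  qed
  show "a i j \<otimes>\<^bsub>G\<^esub> (a i k \<otimes>\<^bsub>G\<^esub> a j k) = a j k \<otimes>\<^bsub>G\<^esub> (a i k \<otimes>\<^bsub>G\<^esub> a i j)"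
    if h: "{i, j, k} \<subseteq> {1..n}" "distinct [i, j, k]"
  proof -
    have "(pos [AD {i, j}, AD {i, k}, AD {j, k}], pos [AD {j, k}, AD {i, k}, AD {i, j}])
        \<in> point_rels n"
      using h unfolding point_rels_def by blast
    from R[OF this] show ?thesis using h cl gs by (simp flip: a_d t_d)
  qed
  show "t i \<otimes>\<^bsub>G\<^esub> t i = \<one>\<^bsub>G\<^esub>" if h: "i \<in> {1..n}"
  proof -
    have "(pos [TD i, TD i], pos []) \<in> point_rels n"
      using h unfolding point_rels_def pos_simps(1) by blast
    from R[OF this] show ?thesis using h cl gs by (simp flip: a_d t_d)
  qed
  show "t i \<otimes>\<^bsub>G\<^esub> t j = t j \<otimes>\<^bsub>G\<^esub> t i" if h: "{i, j} \<subseteq> {1..n}"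
  proof -
    have "(pos [TD i, TD j], pos [TD j, TD i]) \<in> point_rels n"
      using h unfolding point_rels_def by blast
    from R[OF this] show ?thesis using h cl gs by (simp flip: a_d t_d)
  qed
  show "t i \<otimes>\<^bsub>G\<^esub> (t j \<otimes>\<^bsub>G\<^esub> (a i j \<otimes>\<^bsub>G\<^esub> (t j \<otimes>\<^bsub>G\<^esub> t i))) = a i j"
    if h: "{i, j} \<subseteq> {1..n}" "i \<noteq> j"
  proof -
    have "(pos [TD i, TD j, AD {i, j}, TD j, TD i], pos [AD {i, j}]) \<in> point_rels n"
      using h unfolding point_rels_def by blast
    from R[OF this] show ?thesis using h cl gs by (simp flip: a_d t_d)
  qed
  show "a i j \<otimes>\<^bsub>G\<^esub> t k = t k \<otimes>\<^bsub>G\<^esub> a i j"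
    if h: "{i, j, k} \<subseteq> {1..n}" "distinct [i, j, k]"
  proof -
    have "(pos [AD {i, j}, TD k], pos [TD k, AD {i, j}]) \<in> point_rels n"
      using h unfolding point_rels_def by blast
    from R[OF this] show ?thesis using h cl gs by (simp flip: a_d t_d)
  qed
qed

theorem ex_parity_to_points:
  "\<exists>\<phi>\<in>hom (G_parity n) (G_points n). \<forall>i\<in>{1..n}. \<forall>j\<in>{1..n}. i < j \<longrightarrow>
     \<phi> (a_parity n i j 0) = a_points n i j \<and>
     \<phi> (a_parity n i j 1)
       = tau_points n i \<otimes>\<^bsub>G_points n\<^esub> a_points n i j \<otimes>\<^bsub>G_points n\<^esub> tau_points n i"
proof -
  define G where "G = G_points n"
  define a where "a = a_points n"
  define t where "t = tau_points n"
  interpret group G unfolding G_def by (rule group_G_points)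
  define C where "C i x = t i \<otimes>\<^bsub>G\<^esub> x \<otimes>\<^bsub>G\<^esub> t i" for i x
  define F where "F i j e = (if e = (0::nat) then a i j else C i (a i j))" for i j e
  define f where "f g = (case g of AP s e \<Rightarrow> F (Min s) (Max s) e)" for g
  note ac = points_closed(1)[where n = n, folded G_def a_def]
  note tc = points_closed(2)[where n = n, folded G_def t_def]
  note rels = points_relations[where n = n, folded G_def a_def t_def]
  have Cc: "C i x \<in> carrier G" if "i \<in> {1..n}" "x \<in> carrier G" for i x
    using that tc by (simp add: C_def)
  have tt: "t i \<otimes>\<^bsub>G\<^esub> (t i \<otimes>\<^bsub>G\<^esub> x) = x" if "i \<in> {1..n}" "x \<in> carrier G" for i x
    using that tc[of i] rels(4)[of i] by (simp flip: m_assoc)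
  have Cm: "C i (x \<otimes>\<^bsub>G\<^esub> y) = C i x \<otimes>\<^bsub>G\<^esub> C i y"
    if "i \<in> {1..n}" "x \<in> carrier G" "y \<in> carrier G" for i x y
    using that tc[of i] tt[of i] by (simp add: C_def m_assoc)
  have Cf: "C i x = x" if "i \<in> {1..n}" "x \<in> carrier G" "x \<otimes>\<^bsub>G\<^esub> t i = t i \<otimes>\<^bsub>G\<^esub> x" for i x
    using that tc[of i] tt[of i] by (simp add: C_def m_assoc)
  have C1: "C i \<one>\<^bsub>G\<^esub> = \<one>\<^bsub>G\<^esub>" if "i \<in> {1..n}" for i
    using that tc[of i] rels(4)[of i] by (simp add: C_def)
  have CC: "C i (C j x) = C j (C i x)" if "{i, j} \<subseteq> {1..n}" "x \<in> carrier G" for i j x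
  proof -
    have "C i (C j x) = (t i \<otimes>\<^bsub>G\<^esub> t j) \<otimes>\<^bsub>G\<^esub> x \<otimes>\<^bsub>G\<^esub> (t j \<otimes>\<^bsub>G\<^esub> t i)"
      using that tc by (simp add: C_def m_assoc)
    also have "\<dots> = (t j \<otimes>\<^bsub>G\<^esub> t i) \<otimes>\<^bsub>G\<^esub> x \<otimes>\<^bsub>G\<^esub> (t i \<otimes>\<^bsub>G\<^esub> t j)"
      using that rels(5)[of i j] by simp
    also have "\<dots> = C j (C i x)"
      using that tc by (simp add: C_def m_assoc)
    finally show ?thesis .
  qed
  have Cinv: "C i (C i x) = x" if "i \<in> {1..n}" "x \<in> carrier G" for i x
    using that tc[of i] tt[of i] rels(4)[of i] by (simp add: C_def m_assoc)
  have Ca: "C k (a i j) = a i j" if "{i, j, k} \<subseteq> {1..n}" "distinct [i, j, k]" for i j k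
    using that by (intro Cf rels(7) ac) auto
  have Cs: "C i (a i j) = C j (a i j)" if h: "{i, j} \<subseteq> {1..n}" "i \<noteq> j" for i j
  proof -
    have "C i (C j (a i j)) = a i j"
      using rels(6)[OF h] h ac[OF h] tc by (simp add: C_def m_assoc)
    then have "C i (a i j) = C i (C i (C j (a i j)))" by simp
    also have "\<dots> = C j (a i j)" using h ac[OF h] Cc by (simp add: Cinv)
    finally show ?thesis .
  qed
  have a_sym: "a i j = a j i" for i j
    by (simp add: a_def a_points_commute)
  have Fs: "F i j e = F j i e" if "{i, j} \<subseteq> {1..n}" "i \<noteq> j" for i j e
    using Cs[OF that] a_sym[of i j] by (simp add: F_def)
  have Fc: "F i j e \<in> carrier G" if "{i, j} \<subseteq> {1..n}" "i \<noteq> j" for i j e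
    using that ac[OF that] Cc by (simp add: F_def)
  have fF: "f (AP {i, j} e) = F i j e" if "{i, j} \<subseteq> {1..n}" "i \<noteq> j" for i j e
    using that Fs[OF that] by (cases "i < j") (auto simp: f_def)
  have f: "f \<in> parity_gens n \<rightarrow> carrier G"
    using fF Fc by (fastforce simp: parity_gens_def)
  have r1: "F i j e \<otimes>\<^bsub>G\<^esub> F i j e = \<one>\<^bsub>G\<^esub>" if "{i, j} \<subseteq> {1..n}" "i \<noteq> j" for i j e
    using that ac[OF that] rels(1)[OF that] C1[of i] by (simp add: F_def flip: Cm)
  have r2: "F i j e \<otimes>\<^bsub>G\<^esub> F k l e' = F k l e' \<otimes>\<^bsub>G\<^esub> F i j e"
    if h: "{i, j, k, l} \<subseteq> {1..n}" "distinct [i, j, k, l]" for i j k l e e'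
  proof -
    define D where "D x = (if e = 0 then x else C i x)" for x
    define E where "E x = (if e' = 0 then x else C k x)" for x
    have D: "F i j e = E (D (a i j))" and E: "F k l e' = E (D (a k l))"
      using h Ca[of i j k] Ca[of k l i] CC[of k i "a i j"] ac by (auto simp: D_def E_def F_def)
    have DE: "E (D (x \<otimes>\<^bsub>G\<^esub> y)) = E (D x) \<otimes>\<^bsub>G\<^esub> E (D y)"
      if "x \<in> carrier G" "y \<in> carrier G" for x y
      using that h Cm Cc by (simp add: D_def E_def)
    show ?thesis
      using rels(2)[OF h] h ac unfolding D E by (simp flip: DE)
  qed
  have r3: "F i j e \<otimes>\<^bsub>G\<^esub> (F i k e' \<otimes>\<^bsub>G\<^esub> F j k e'') = F j k e'' \<otimes>\<^bsub>G\<^esub> (F i k e' \<otimes>\<^bsub>G\<^esub> F i j e)"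
    if h: "{i, j, k} \<subseteq> {1..n}" "distinct [i, j, k]" and e: "{e, e', e''} \<subseteq> {0, 1}"
      "even (e + e' + e'')" for i j k e e' e''
  proof -
    have cl: "a i j \<in> carrier G" "a i k \<in> carrier G" "a j k \<in> carrier G" using h ac by auto
    have C: ?thesis
      if c: "c \<in> {i, j, k}" "F i j e = C c (a i j)" "F i k e' = C c (a i k)" "F j k e'' = C c (a j k)"
      for c
    proof -
      have "c \<in> {1..n}" using c h by auto
      then show ?thesis using rels(3)[OF h] cl unfolding c(2-4) by (simp flip: Cm)
    qed
    from e consider "e = 0" "e' = 0" "e'' = 0" | "e = 1" "e' = 1" "e'' = 0"
      | "e = 1" "e' = 0" "e'' = 1" | "e = 0" "e' = 1" "e'' = 1" by auto
    then show ?thesis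
    proof cases
      case 1
      then show ?thesis using rels(3)[OF h] by (simp add: F_def)
    next
      case 2
      then show ?thesis using h Ca[of j k i] by (intro C[of i]) (auto simp: F_def)
    next
      case 3
      then show ?thesis using h Ca[of i k j] Cs[of i j] by (intro C[of j]) (auto simp: F_def)
    next
      case 4
      then show ?thesis using h Ca[of i j k] Cs[of i k] Cs[of j k]
        by (intro C[of k]) (auto simp: F_def)
    qed
  qed
  have R: "word_val G f u = word_val G f v" if "(u, v) \<in> parity_rels n" for u v
  proof -
    from that consider
      (sq) i j e where "u = pos [AP {i, j} e, AP {i, j} e]" "v = []" "{i, j} \<subseteq> {1..n}" "i \<noteq> j"
    | (far) i j k l e e' where "u = pos [AP {i, j} e, AP {k, l} e']"
        "v = pos [AP {k, l} e', AP {i, j} e]" "{i, j, k, l} \<subseteq> {1..n}" "distinct [i, j, k, l]"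
    | (tri) i j k e e' e'' where "u = pos [AP {i, j} e, AP {i, k} e', AP {j, k} e'']"
        "v = pos [AP {j, k} e'', AP {i, k} e', AP {i, j} e]" "{i, j, k} \<subseteq> {1..n}"
        "distinct [i, j, k]" "{e, e', e''} \<subseteq> {0, 1}" "even (e + e' + e'')"
      unfolding parity_rels_def Un_iff mem_Collect_eq prod.inject
      by (elim disjE exE conjE) ((rule that(1); assumption), (rule that(2); assumption),
          (rule that(3); assumption))
    then show ?thesis
    proof cases
      case sq
      then show ?thesis using r1[of i j e] Fc by (simp add: fF)
    next
      case far
      then show ?thesis using r2[of i j k l e e'] Fc by (simp add: fF)
    next
      case tri
      then show ?thesis using r3[of i j k e e' e''] Fc by (simp add: fF)
    qed
  qed
  have "\<exists>h\<in>hom (presented_group (parity_gens n) (parity_rels n)) G.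
      \<forall>x\<in>parity_gens n. h (pres_gen (parity_gens n) (parity_rels n) x) = f x"
    by (rule presented_group_lift[OF f R])
  then obtain \<phi>
    where \<phi>: "\<phi> \<in> hom (G_parity n) G"
      "\<And>x. x \<in> parity_gens n \<Longrightarrow> \<phi> (pres_gen (parity_gens n) (parity_rels n) x) = f x"
    unfolding G_parity_def by blast
  have "\<phi> (a_parity n i j e) = F i j e" if "i \<in> {1..n}" "j \<in> {1..n}" "i < j" "e \<in> {0, 1}" for i j e
  proof -
    have "AP {i, j} e \<in> parity_gens n"
      using that unfolding parity_gens_def by blast
    then show ?thesis
      using that fF[of i j e] by (simp add: a_parity_def \<phi>(2))
  qed
  then show ?thesis
    using \<phi>(1) unfolding G_def[symmetric] a_def[symmetric] t_def[symmetric]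
    by (intro bexI[of _ \<phi>]) (auto simp: F_def C_def)
qed

end

theory Submission
  imports Defs "HOL-Algebra.Bij"
begin

text \<open>
  Switching the parity label on all generators \<open>a\<^sub>i\<^sub>j\<^sup>\<epsilon>\<close> with \<open>k \<in> {i, j}\<close> preserves the
  relations of the group with parity \<open>G\<close>, since a triangle has no or two sides at \<open>k\<close>; hence it
  defines an involution \<open>T\<^sub>k\<close> of \<open>G\<close>. Letting \<open>a\<^sub>i\<^sub>j\<close> act on the set \<open>G\<close> by left multiplication
  with \<open>a\<^sub>i\<^sub>j\<^sup>0\<close> and \<open>\<tau>\<^sub>k\<close> by \<open>T\<^sub>k\<close> gives an action of the group with points. Its pullback along
  \<open>\<phi>\<close> is the left regular action of \<open>G\<close>, which is faithful, so \<open>\<phi>\<close> is injective. This replaces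
  the semidirect product of \<open>G\<close> with \<open>(\<int>/2)\<^sup>n\<close> by a permutation group.
\<close>

section \<open>Homomorphisms out of a presented group\<close>

lemma inv_pres_gen:
  assumes "x \<in> S"
  shows "inv\<^bsub>presented_group S R\<^esub> (pres_gen S R x) = pres_rel S R `` {[(x, True)]}"
proof (rule group.inv_equality[OF group_presented_group])
  show "pres_rel S R `` {[(x, True)]} \<otimes>\<^bsub>presented_group S R\<^esub> pres_gen S R x
      = \<one>\<^bsub>presented_group S R\<^esub>"
    using pres_rel.cancel[OF assms, of True] assms
    by (simp add: pres_gen_def mult_presented_group one_presented_group pres_class_eq_iff)
qed (use assms in \<open>auto simp: pres_gen_def intro!: quotientI\<close>)

lemma word_val_pres_gen:
  assumes "w \<in> words S"
  shows "word_val (presented_group S R) (pres_gen S R) w = pres_rel S R `` {w}"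
  using assms
proof (induction w)
  case (Cons a w)
  obtain x b where a: "a = (x, b)" by (cases a)
  with Cons have "x \<in> S" "w \<in> words S" by auto
  then show ?case
    using Cons.IH by (simp add: a inv_pres_gen) (simp add: pres_gen_def mult_presented_group)
qed (simp add: one_presented_group)

text \<open>Each letter is a generator or, by \<open>inv_pres_gen\<close>, the inverse of one, so
  peeling off letters reduces \<open>h\<close> to its values on generators. This yields the
  uniqueness half of the universal property, \<open>presented_group_hom_eqI\<close>.\<close>

lemma (in group) hom_word_val_pres_gen:
  assumes h: "h \<in> hom (presented_group S R) G" and "w \<in> words S"
  shows "h (pres_rel S R `` {w}) = word_val G (\<lambda>x. h (pres_gen S R x)) w"
  using assms(2)
proof (induction w)
  interpret h: group_hom "presented_group S R" G h
    using h group_presented_group by (simp add: group_hom_def group_hom_axioms_def is_group)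
  {
    case Nil
    then show ?case using h.hom_one by (simp add: one_presented_group)
  next
    case (Cons a w)
    obtain x b where a: "a = (x, b)" by (cases a)
    with Cons have xw: "x \<in> S" "w \<in> words S" by auto
    have "pres_rel S R `` {a # w}
        = pres_rel S R `` {[a]} \<otimes>\<^bsub>presented_group S R\<^esub> pres_rel S R `` {w}"
      using xw a by (simp add: mult_presented_group)
    moreover have "h (pres_rel S R `` {[a]})
        = (if b then inv (h (pres_gen S R x)) else h (pres_gen S R x))"
      using h.hom_inv[OF pres_gen_closed[OF xw(1)]] xw
      by (simp add: a inv_pres_gen) (simp add: pres_gen_def)
    ultimately show ?case
      using Cons.IH[OF xw(2)] xw a by (simp add: h.hom_mult quotientI)
  }
qed

lemma word_val_cong_gens:
  assumes "\<And>x. x \<in> S \<Longrightarrow> f x = g x" "w \<in> words S"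
  shows "word_val H f w = word_val H g w"
  using assms(2) by (induction w) (auto simp: assms(1))

lemma (in group) presented_group_hom_eqI:
  assumes "h \<in> hom (presented_group S R) G" "k \<in> hom (presented_group S R) G"
    and "\<And>x. x \<in> S \<Longrightarrow> h (pres_gen S R x) = k (pres_gen S R x)"
    and "X \<in> carrier (presented_group S R)"
  shows "h X = k X"
proof -
  from assms(4) obtain w where "w \<in> words S" "X = pres_rel S R `` {w}"
    by (auto elim: quotientE)
  then show ?thesis
    using word_val_cong_gens[OF assms(3)] by (simp add: assms(1,2) hom_word_val_pres_gen)
qed

lemma word_val_comp: "word_val H (f \<circ> \<sigma>) w = word_val H f (map (apfst \<sigma>) w)"
  by (induction w) auto

lemma map_apfst_words: "\<sigma> \<in> S \<rightarrow> S' \<Longrightarrow> w \<in> words S \<Longrightarrow> map (apfst \<sigma>) w \<in> words S'"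
  by (induction w) auto

text \<open>By \<open>word_val_comp\<close> and \<open>word_val_pres_gen\<close>, the value of a
  word under \<open>pres_gen S R \<circ> \<sigma>\<close> is the class of the substituted word.
  Since \<open>\<sigma>\<close> carries relations to relations, these values respect
  \<open>R\<close> and the universal property applies.\<close>

lemma presented_group_endo:
  assumes \<sigma>: "\<sigma> \<in> S \<rightarrow> S"
    and R: "\<And>u v. (u, v) \<in> R \<Longrightarrow> u \<in> words S \<and> v \<in> words S
      \<and> (map (apfst \<sigma>) u, map (apfst \<sigma>) v) \<in> R"
  shows "\<exists>h\<in>hom (presented_group S R) (presented_group S R).
    \<forall>x\<in>S. h (pres_gen S R x) = pres_gen S R (\<sigma> x)"
proof -
  interpret group "presented_group S R" by (rule group_presented_group)
  have "pres_gen S R \<circ> \<sigma> \<in> S \<rightarrow> carrier (presented_group S R)"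
    using \<sigma> pres_gen_closed[of _ S R] by fastforce
  moreover have "word_val (presented_group S R) (pres_gen S R \<circ> \<sigma>) u
      = word_val (presented_group S R) (pres_gen S R \<circ> \<sigma>) v" if "(u, v) \<in> R" for u v
    using R[OF that] map_apfst_words[OF \<sigma>]
    by (simp add: word_val_comp word_val_pres_gen pres_class_eq_iff pres_rel.rel)
  ultimately show ?thesis
    using presented_group_lift[of "pres_gen S R \<circ> \<sigma>" S R] by simp
qed

section \<open>Switching parity labels\<close>

text \<open>Subtraction is truncated on \<open>nat\<close>: \<open>1 - e\<close> exchanges 0 and 1
  but sends larger labels to 0. Hence \<open>switch k\<close> is shown to be an involution only on
  \<open>parity_gens n\<close>.\<close>

fun switch :: "nat \<Rightarrow> parity_gen \<Rightarrow> parity_gen" where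
  "switch k (AP s e) = AP s (if k \<in> s then 1 - e else e)"

lemma AP_in_parity_gens:
  assumes "{i, j} \<subseteq> {1..n}" "i \<noteq> j" "e \<in> {0, 1}"
  shows "AP {i, j} e \<in> parity_gens n"
  using assms
proof (induction i j rule: linorder_wlog)
  case (le i j)
  then have "i \<in> {1..n} \<and> j \<in> {1..n} \<and> i < j \<and> e \<in> {0, 1}" by auto
  then show ?case unfolding parity_gens_def by blast
next
  case (sym i j)
  then show ?case by (simp add: insert_commute)
qed

lemma parity_gensE:
  assumes "x \<in> parity_gens n"
  obtains i j e where "x = AP {i, j} e" "{i, j} \<subseteq> {1..n}" "i < j" "e \<in> {0, 1}"
  using assms unfolding parity_gens_def by auto

lemma parity_relsE:
  assumes "(u, v) \<in> parity_rels n"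
  obtains
    (square) i j e where "u = pos [AP {i, j} e, AP {i, j} e]" "v = []"
      "{i, j} \<subseteq> {1..n}" "i \<noteq> j" "e \<in> {0, 1}"
  | (far) i j k l e e' where "u = pos [AP {i, j} e, AP {k, l} e']"
      "v = pos [AP {k, l} e', AP {i, j} e]" "{i, j, k, l} \<subseteq> {1..n}" "distinct [i, j, k, l]"
      "{e, e'} \<subseteq> {0, 1}"
  | (triangle) i j k e e' e'' where "u = pos [AP {i, j} e, AP {i, k} e', AP {j, k} e'']"
      "v = pos [AP {j, k} e'', AP {i, k} e', AP {i, j} e]" "{i, j, k} \<subseteq> {1..n}"
      "distinct [i, j, k]" "{e, e', e''} \<subseteq> {0, 1}" "even (e + e' + e'')"
  using assms unfolding parity_rels_def Un_iff mem_Collect_eq prod.inject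
  by (elim disjE exE conjE) ((rule that(1); assumption), (rule that(2); assumption),
      (rule that(3); assumption))

lemma parity_relsI:
  shows "{i, j} \<subseteq> {1..n} \<Longrightarrow> i \<noteq> j \<Longrightarrow> e \<in> {0, 1} \<Longrightarrow>
      (pos [AP {i, j} e, AP {i, j} e], []) \<in> parity_rels n"
    and "{i, j, k, l} \<subseteq> {1..n} \<Longrightarrow> distinct [i, j, k, l] \<Longrightarrow> {e, e'} \<subseteq> {0, 1} \<Longrightarrow>
      (pos [AP {i, j} e, AP {k, l} e'], pos [AP {k, l} e', AP {i, j} e]) \<in> parity_rels n"
    and "{i, j, k} \<subseteq> {1..n} \<Longrightarrow> distinct [i, j, k] \<Longrightarrow> {e, e', e''} \<subseteq> {0, 1} \<Longrightarrow>
      even (e + e' + e'') \<Longrightarrow>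
      (pos [AP {i, j} e, AP {i, k} e', AP {j, k} e''],
       pos [AP {j, k} e'', AP {i, k} e', AP {i, j} e]) \<in> parity_rels n"
  unfolding parity_rels_def by blast+

lemma switch_closed: "switch k \<in> parity_gens n \<rightarrow> parity_gens n"
  by (auto elim!: parity_gensE intro!: AP_in_parity_gens)

text \<open>The two letters of a square receive the same new label, and far commutation puts no
  parity condition on labels. In a triangle, a vertex \<open>m\<close> lies on exactly two sides, so
  two labels flip and the parity of the sum is kept.\<close>

lemma switch_parity_rels:
  assumes "(u, v) \<in> parity_rels n"
  shows "u \<in> words (parity_gens n) \<and> v \<in> words (parity_gens n)
    \<and> (map (apfst (switch m)) u, map (apfst (switch m)) v) \<in> parity_rels n"
  using assms
proof (cases rule: parity_relsE)
  case (square i j e)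
  let ?d = "if m \<in> {i, j} then 1 - e else e"
  have "(pos [AP {i, j} ?d, AP {i, j} ?d], []) \<in> parity_rels n"
    using square by (intro parity_relsI) auto
  then show ?thesis using square by (simp add: AP_in_parity_gens)
next
  case (far i j k l e e')
  let ?d = "if m \<in> {i, j} then 1 - e else e" and ?d' = "if m \<in> {k, l} then 1 - e' else e'"
  have "(pos [AP {i, j} ?d, AP {k, l} ?d'], pos [AP {k, l} ?d', AP {i, j} ?d]) \<in> parity_rels n"
    using far by (intro parity_relsI) auto
  then show ?thesis using far by (simp add: AP_in_parity_gens)
next
  case (triangle i j k e e' e'')
  let ?d = "if m \<in> {i, j} then 1 - e else e" and ?d' = "if m \<in> {i, k} then 1 - e' else e'"
    and ?d'' = "if m \<in> {j, k} then 1 - e'' else e''"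
  have "(pos [AP {i, j} ?d, AP {i, k} ?d', AP {j, k} ?d''],
      pos [AP {j, k} ?d'', AP {i, k} ?d', AP {i, j} ?d]) \<in> parity_rels n"
    using triangle by (intro parity_relsI) auto
  then show ?thesis using triangle by (simp add: AP_in_parity_gens)
qed

lemma switch_switch: "x \<in> parity_gens n \<Longrightarrow> switch k (switch k x) = x"
  by (auto elim!: parity_gensE)

lemma switch_commute: "switch k (switch m x) = switch m (switch k x)"
  by (cases x) auto

lemma a_parity_closed:
  "{i, j} \<subseteq> {1..n} \<Longrightarrow> i \<noteq> j \<Longrightarrow> e \<in> {0, 1} \<Longrightarrow> a_parity n i j e \<in> carrier (G_parity n)"
  unfolding a_parity_def G_parity_def by (intro pres_gen_closed AP_in_parity_gens)

text \<open>Three labels 0 have even sum, so the triangle relation is available for them. Thus the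
  label-0 generators satisfy those relations of the group with points that do not involve
  \<open>TD\<close>.\<close>

lemma a_parity_relations:
  fixes n :: nat
  defines "G \<equiv> G_parity n" and "a \<equiv> \<lambda>i j. a_parity n i j 0"
  shows "{i, j} \<subseteq> {1..n} \<Longrightarrow> i \<noteq> j \<Longrightarrow> a i j \<otimes>\<^bsub>G\<^esub> a i j = \<one>\<^bsub>G\<^esub>"
    and "{i, j, k, l} \<subseteq> {1..n} \<Longrightarrow> distinct [i, j, k, l] \<Longrightarrow> a i j \<otimes>\<^bsub>G\<^esub> a k l = a k l \<otimes>\<^bsub>G\<^esub> a i j"
    and "{i, j, k} \<subseteq> {1..n} \<Longrightarrow> distinct [i, j, k] \<Longrightarrow>
      a i j \<otimes>\<^bsub>G\<^esub> (a i k \<otimes>\<^bsub>G\<^esub> a j k) = a j k \<otimes>\<^bsub>G\<^esub> (a i k \<otimes>\<^bsub>G\<^esub> a i j)"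
  unfolding G_def a_def G_parity_def a_parity_def pres_gen_def
  using parity_relsI(1)[where n = n and e = 0] parity_relsI(2)[where n = n and e = 0 and e' = 0]
    parity_relsI(3)[where n = n and e = 0 and e' = 0 and e'' = 0]
    AP_in_parity_gens[where n = n and e = 0]
  by (auto simp: mult_presented_group one_presented_group pres_class_eq_iff intro!: pres_rel.rel)

lemma ex_switch_hom:
  "\<exists>T\<in>hom (G_parity n) (G_parity n). \<forall>x\<in>parity_gens n.
     T (pres_gen (parity_gens n) (parity_rels n) x)
       = pres_gen (parity_gens n) (parity_rels n) (switch k x)"
  unfolding G_parity_def by (rule presented_group_endo[OF switch_closed switch_parity_rels])


section \<open>Cases of the point relations, and the left regular representation\<close>

lemma point_relsE:
  assumes "(u, v) \<in> point_rels n"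
  obtains
    (square) i j where "u = pos [AD {i, j}, AD {i, j}]" "v = []" "{i, j} \<subseteq> {1..n}" "i \<noteq> j"
  | (far) i j k l where "u = pos [AD {i, j}, AD {k, l}]" "v = pos [AD {k, l}, AD {i, j}]"
      "{i, j, k, l} \<subseteq> {1..n}" "distinct [i, j, k, l]"
  | (triangle) i j k where "u = pos [AD {i, j}, AD {i, k}, AD {j, k}]"
      "v = pos [AD {j, k}, AD {i, k}, AD {i, j}]" "{i, j, k} \<subseteq> {1..n}" "distinct [i, j, k]"
  | (tau_square) i where "u = pos [TD i, TD i]" "v = []" "i \<in> {1..n}"
  | (tau_commute) i j where "u = pos [TD i, TD j]" "v = pos [TD j, TD i]" "{i, j} \<subseteq> {1..n}"
  | (tau_near) i j where "u = pos [TD i, TD j, AD {i, j}, TD j, TD i]" "v = pos [AD {i, j}]"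
      "{i, j} \<subseteq> {1..n}" "i \<noteq> j"
  | (tau_far) i j k where "u = pos [AD {i, j}, TD k]" "v = pos [TD k, AD {i, j}]"
      "{i, j, k} \<subseteq> {1..n}" "distinct [i, j, k]"
  using assms unfolding point_rels_def Un_iff mem_Collect_eq prod.inject
  by (elim disjE exE conjE) ((rule that(1); assumption), (rule that(2); assumption),
      (rule that(3); assumption), (rule that(4); assumption), (rule that(5); assumption),
      (rule that(6); assumption), (rule that(7); assumption))

text \<open>Cayley's representation. The restriction to the carrier is there because elements of
  \<open>Bij\<close> are extensional functions.\<close>

lemma (in group) left_mult_BijGroup:
  "(\<lambda>g. \<lambda>x\<in>carrier G. g \<otimes> x) \<in> hom G (BijGroup (carrier G))"
proof -
  have Bij: "(\<lambda>x\<in>carrier G. g \<otimes> x) \<in> Bij (carrier G)" if g: "g \<in> carrier G" for g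
  proof -
    have "bij_betw (\<lambda>x. g \<otimes> x) (carrier G) (carrier G)"
      by (rule bij_betw_byWitness[where f' = "\<lambda>x. inv g \<otimes> x"])
        (use g in \<open>auto simp flip: m_assoc\<close>)
    then show ?thesis by (simp add: Bij_def bij_betw_restrict_eq)
  qed
  then show ?thesis
    by (auto intro!: homI simp: BijGroup_def compose_def m_assoc fun_eq_iff restrict_def)
qed

section \<open>The involutions \<open>T k\<close> of the group with parity\<close>

locale switching =
  fixes n :: nat and T :: "nat \<Rightarrow> parity_gen word set \<Rightarrow> parity_gen word set"
  assumes T_hom: "T k \<in> hom (G_parity n) (G_parity n)"
    and T_pres_gen: "x \<in> parity_gens n \<Longrightarrow> T k (pres_gen (parity_gens n) (parity_rels n) x)
      = pres_gen (parity_gens n) (parity_rels n) (switch k x)"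
begin

sublocale group "G_parity n" by (rule group_G_parity)

abbreviation S where "S \<equiv> carrier (G_parity n)"
abbreviation a where "a i j \<equiv> a_parity n i j 0"
abbreviation mult (infixl "\<cdot>" 70) where "x \<cdot> y \<equiv> x \<otimes>\<^bsub>G_parity n\<^esub> y"

lemma T_closed: "x \<in> S \<Longrightarrow> T k x \<in> S"
  using T_hom by (auto simp: hom_def)

lemma T_mult: "x \<in> S \<Longrightarrow> y \<in> S \<Longrightarrow> T k (x \<cdot> y) = T k x \<cdot> T k y"
  using T_hom by (auto simp: hom_def)

text \<open>The target \<open>H\<close> is left general: it is the group with parity for the
  identities between the \<open>T k\<close>, and the permutation group when \<open>\<phi>\<close> is
  compared with the regular action.\<close>

lemma pres_gen_eqI:
  assumes "group H" "h \<in> hom (G_parity n) H" "k \<in> hom (G_parity n) H"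
    and "\<And>x. x \<in> parity_gens n \<Longrightarrow> h (pres_gen (parity_gens n) (parity_rels n) x)
      = k (pres_gen (parity_gens n) (parity_rels n) x)"
    and "X \<in> S"
  shows "h X = k X"
  using assms group.presented_group_hom_eqI unfolding G_parity_def[of n] by blast

lemma switch_gens: "x \<in> parity_gens n \<Longrightarrow> switch k x \<in> parity_gens n"
  using switch_closed by blast

lemma T_comp_hom: "T k \<circ> T m \<in> hom (G_parity n) (G_parity n)"
  by (rule Group.hom_compose[OF T_hom T_hom])

text \<open>Both \<open>T k \<circ> T k\<close> and the identity are homomorphisms, and they agree
  on generators by \<open>switch_switch\<close>.\<close>

lemma T_T:
  assumes "x \<in> S"
  shows "T k (T k x) = x"
proof -
  have "id \<in> hom (G_parity n) (G_parity n)"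
    by (simp add: hom_def)
  from pres_gen_eqI[OF is_group T_comp_hom this _ assms, of k k] show ?thesis
    by (simp add: T_pres_gen switch_gens switch_switch)
qed

lemma T_commute:
  assumes "x \<in> S"
  shows "T k (T m x) = T m (T k x)"
  using pres_gen_eqI[OF is_group T_comp_hom T_comp_hom _ assms, of k m m k]
  by (simp add: T_pres_gen switch_gens switch_commute[of k m])

lemma T_a_parity:
  assumes "{i, j} \<subseteq> {1..n}" "i \<noteq> j" "e \<in> {0, 1}"
  shows "T k (a_parity n i j e) = a_parity n i j (if k \<in> {i, j} then 1 - e else e)"
  using AP_in_parity_gens[OF assms] by (simp add: a_parity_def T_pres_gen)

section \<open>The action of the group with points on \<open>S\<close>\<close>

abbreviation B where "B \<equiv> BijGroup S"

definition left where "left g = (\<lambda>x\<in>S. g \<cdot> x)"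

definition act :: "point_gen \<Rightarrow> parity_gen word set \<Rightarrow> parity_gen word set" where
  "act p = (case p of AD s \<Rightarrow> left (pres_gen (parity_gens n) (parity_rels n) (AP s 0))
    | TD k \<Rightarrow> restrict (T k) S)"

lemma group_B: "group B"
  by (rule group_BijGroup)

lemma left_hom: "left \<in> hom (G_parity n) B"
  using left_mult_BijGroup unfolding left_def .

lemma left_closed: "g \<in> S \<Longrightarrow> left g \<in> carrier B"
  using left_hom by (auto simp: hom_def)

text \<open>A left multiplication is recovered from its value at the unit, so the regular action is
  faithful.\<close>

lemma inj_left: "inj_on left S"
proof (rule inj_onI)
  fix g h assume gh: "g \<in> S" "h \<in> S" "left g = left h"
  have "left k \<one>\<^bsub>G_parity n\<^esub> = k" if "k \<in> S" for k
    using that by (simp add: left_def)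
  with gh show "g = h" by metis
qed

lemma act_AD: "act (AD {i, j}) = left (a i j)"
  by (simp add: act_def a_parity_def)

lemma act_TD: "act (TD k) = restrict (T k) S"
  by (simp add: act_def)

lemma T_Bij: "restrict (T k) S \<in> carrier B"
proof -
  have "bij_betw (T k) S S"
    by (rule bij_betw_byWitness[where f' = "T k"]) (auto simp: T_T T_closed)
  then show ?thesis by (simp add: BijGroup_def Bij_def bij_betw_restrict_eq)
qed

lemma act_closed: "act \<in> point_gens n \<rightarrow> carrier B"
  by (auto simp: point_gens_def act_AD act_TD T_Bij left_closed a_parity_closed)

lemma B_eqI:
  assumes "f \<in> carrier B" "g \<in> carrier B" "\<And>x. x \<in> S \<Longrightarrow> f x = g x"
  shows "f = g"
  using assms by (auto simp: BijGroup_def Bij_def intro: extensionalityI)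

lemma B_mult: "f \<in> carrier B \<Longrightarrow> g \<in> carrier B \<Longrightarrow> x \<in> S \<Longrightarrow> (f \<otimes>\<^bsub>B\<^esub> g) x = f (g x)"
  by (simp add: BijGroup_def compose_eq)

lemma B_one: "x \<in> S \<Longrightarrow> \<one>\<^bsub>B\<^esub> x = x"
  by (simp add: BijGroup_def)

text \<open>Lets a word act on a point letter by letter, the first letter acting last, with no
  products of permutations to simplify. Positive letters suffice because both sides of every point
  relation are \<open>pos\<close> words.\<close>

lemma word_val_act_Cons:
  assumes "p \<in> point_gens n" "w \<in> words (point_gens n)" "x \<in> S"
  shows "word_val B act ((p, False) # w) x = act p (word_val B act w x)"
  using B_mult[OF funcset_mem[OF act_closed assms(1)]
      group.word_val_closed[OF group_B act_closed assms(2)] assms(3)] by simp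

text \<open>Checked at each point \<open>x\<close>. Relations among the \<open>AD\<close> letters
  become label-0 relations multiplied by \<open>x\<close>. In those with \<open>TD\<close>,
  \<open>T k\<close> is pushed through a product by \<open>T_mult\<close> and changes the label
  exactly when \<open>k\<close> is an index of the generator.\<close>

lemma act_rels:
  assumes "(u, v) \<in> point_rels n"
  shows "word_val B act u = word_val B act v"
proof -
  note gens = AD_in_point_gens TD_in_point_gens
  \<comment> \<open>These rules evaluate a word at a point. Below, \<open>word_val.simps(2)\<close>
    is removed from the simplifier so that it does not unfold the word into a product in
    \<open>B\<close> before \<open>word_val_act_Cons\<close> applies.\<close>
  note ev = word_val_act_Cons gens act_AD act_TD left_def a_parity_closed T_closed T_mult T_T
    T_a_parity B_one
  have uv: "u \<in> words (point_gens n)" "v \<in> words (point_gens n)"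
    using assms by (cases rule: point_relsE; simp add: gens)+
  show ?thesis
  proof (rule B_eqI)
    show "word_val B act u \<in> carrier B" "word_val B act v \<in> carrier B"
      using uv by (simp_all add: group.word_val_closed[OF group_B act_closed])
  next
    fix x assume x: "x \<in> S"
    from assms show "word_val B act u x = word_val B act v x"
    proof (cases rule: point_relsE)
      case (square i j)
      then show ?thesis using x a_parity_relations(1)[of i j n]
        by (simp add: ev del: word_val.simps(2) flip: m_assoc)
    next
      case (far i j k l)
      then show ?thesis using x a_parity_relations(2)[of i j k l n]
        by (simp add: ev del: word_val.simps(2) flip: m_assoc)
    next
      case (triangle i j k)
      have "a i j \<cdot> (a i k \<cdot> a j k) \<cdot> x = a j k \<cdot> (a i k \<cdot> a i j) \<cdot> x"
        using triangle a_parity_relations(3)[of i j k n] by simp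
      then show ?thesis using x triangle
        by (simp add: ev m_assoc del: word_val.simps(2))
    next
      case (tau_square i)
      then show ?thesis using x by (simp add: ev del: word_val.simps(2))
    next
      case (tau_commute i j)
      then show ?thesis using x T_commute by (simp add: ev del: word_val.simps(2))
    next
      case (tau_near i j)
      \<comment> \<open>The label of the generator is flipped by both \<open>T i\<close> and
        \<open>T j\<close>, so it returns to 0; on \<open>x\<close> the four maps cancel once
        \<open>T i\<close> and \<open>T j\<close> are commuted.\<close>
      then show ?thesis using x by (simp add: ev T_commute[of _ i j] del: word_val.simps(2))
    next
      case (tau_far i j k)
      then show ?thesis using x by (simp add: ev del: word_val.simps(2))
    qed
  qed
qed

text \<open>The universal property of the group with points turns \<open>act\<close> into a
  homomorphism \<open>\<psi>\<close>; composed with \<open>\<phi>\<close> it will give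
  \<open>left\<close>.\<close>

lemma left_factors:
  obtains \<psi> where "\<psi> \<in> hom (G_points n) B"
    and "\<And>i j. {i, j} \<subseteq> {1..n} \<Longrightarrow> i \<noteq> j \<Longrightarrow> \<psi> (a_points n i j) = left (a i j)"
    and "\<And>k. k \<in> {1..n} \<Longrightarrow> \<psi> (tau_points n k) = restrict (T k) S"
proof -
  obtain \<psi> where "\<psi> \<in> hom (G_points n) B"
    "\<forall>p\<in>point_gens n. \<psi> (pres_gen (point_gens n) (point_rels n) p) = act p"
    using group.presented_group_lift[OF group_B act_closed act_rels]
    unfolding G_points_def by blast
  then show thesis
    using that AD_in_point_gens TD_in_point_gens
    unfolding a_points_def tau_points_def by (simp add: act_AD act_TD)
qed

text \<open>At \<open>x\<close> the left side is \<open>T k (g \<cdot> T k x)\<close>, which is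
  \<open>T k g \<cdot> x\<close> because \<open>T k\<close> is a multiplicative involution. This is
  the counterpart of conjugation by \<open>\<tau>\<close> in the definition of
  \<open>\<phi>\<close>.\<close>

lemma left_switch:
  assumes "g \<in> S"
  shows "restrict (T k) S \<otimes>\<^bsub>B\<^esub> left g \<otimes>\<^bsub>B\<^esub> restrict (T k) S = left (T k g)"
proof -
  interpret B: group B by (rule group_B)
  have Tg: "restrict (T k) S \<otimes>\<^bsub>B\<^esub> left g \<in> carrier B"
    using assms by (intro B.m_closed T_Bij left_closed)
  show ?thesis
  proof (rule B_eqI)
    fix x assume x: "x \<in> S"
    have "(restrict (T k) S \<otimes>\<^bsub>B\<^esub> left g \<otimes>\<^bsub>B\<^esub> restrict (T k) S) x
        = restrict (T k) S (left g (restrict (T k) S x))"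
      using assms x Tg by (simp add: B_mult T_Bij left_closed T_closed)
    then show "(restrict (T k) S \<otimes>\<^bsub>B\<^esub> left g \<otimes>\<^bsub>B\<^esub> restrict (T k) S) x = left (T k g) x"
      using assms x by (simp add: left_def T_closed T_mult T_T)
  qed (use assms Tg in \<open>auto intro: B.m_closed T_Bij left_closed T_closed\<close>)
qed

end

section \<open>Injectivity of \<open>\<phi>\<close>\<close>

theorem mainTheorem2:
  fixes n :: nat and \<phi> :: "parity_gen word set \<Rightarrow> point_gen word set"
  assumes "n \<ge> 1"
    and "\<phi> \<in> hom (G_parity n) (G_points n)"
    and "\<And>i j. \<lbrakk>i \<in> {1..n}; j \<in> {1..n}; i < j\<rbrakk> \<Longrightarrow> \<phi> (a_parity n i j 0) = a_points n i j"
    and "\<And>i j. \<lbrakk>i \<in> {1..n}; j \<in> {1..n}; i < j\<rbrakk> \<Longrightarrow>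
      \<phi> (a_parity n i j 1)
        = tau_points n i \<otimes>\<^bsub>G_points n\<^esub> a_points n i j \<otimes>\<^bsub>G_points n\<^esub> tau_points n i"
  shows "(\<forall>x\<in>carrier (G_parity n). \<forall>y\<in>carrier (G_parity n). \<phi> x = \<phi> y \<longrightarrow> x = y)
    \<and> \<phi> \<in> mon (G_parity n) (G_points n)"
proof -
  obtain T where "\<forall>k. T k \<in> hom (G_parity n) (G_parity n) \<and> (\<forall>x\<in>parity_gens n.
     T k (pres_gen (parity_gens n) (parity_rels n) x)
       = pres_gen (parity_gens n) (parity_rels n) (switch k x))"
    using ex_switch_hom[of n] by metis
  then interpret switching n T by unfold_locales auto
  obtain \<psi> where \<psi>: "\<psi> \<in> hom (G_points n) B"
    and \<psi>_a: "\<And>i j. {i, j} \<subseteq> {1..n} \<Longrightarrow> i \<noteq> j \<Longrightarrow> \<psi> (a_points n i j) = left (a i j)"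
    and \<psi>_tau: "\<And>k. k \<in> {1..n} \<Longrightarrow> \<psi> (tau_points n k) = restrict (T k) S"
    using left_factors by blast
  interpret P: group "G_points n" by (rule group_G_points)
  have \<psi>_mult: "\<psi> (x \<otimes>\<^bsub>G_points n\<^esub> y) = \<psi> x \<otimes>\<^bsub>B\<^esub> \<psi> y"
    if "x \<in> carrier (G_points n)" "y \<in> carrier (G_points n)" for x y
    using \<psi> that by (auto simp: hom_def)
  have gens: "(\<psi> \<circ> \<phi>) (pres_gen (parity_gens n) (parity_rels n) x)
      = left (pres_gen (parity_gens n) (parity_rels n) x)" if "x \<in> parity_gens n" for x
    using that
  proof (cases rule: parity_gensE)
    case (1 i j e)
    then have ij: "i \<in> {1..n}" "j \<in> {1..n}" "i < j" by auto
    have "\<psi> (\<phi> (a_parity n i j 0)) = left (a_parity n i j 0)"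
      using ij by (simp add: assms(3) \<psi>_a)
    \<comment> \<open>Under \<open>\<psi>\<close>, conjugation by \<open>tau_points n i\<close>
      becomes conjugation by \<open>T i\<close>, which by \<open>left_switch\<close> applies
      \<open>T i\<close> to the label-0 generator and so turns its label into 1.\<close>
    moreover have "\<psi> (\<phi> (a_parity n i j 1)) = left (a_parity n i j 1)"
      unfolding assms(4)[OF ij] using ij
      by (simp add: \<psi>_mult \<psi>_a \<psi>_tau points_closed left_switch a_parity_closed T_a_parity)
    ultimately show ?thesis using 1 unfolding a_parity_def by auto
  qed
  have hom: "\<psi> \<circ> \<phi> \<in> hom (G_parity n) B"
    using assms(2) \<psi> by (rule Group.hom_compose)
  have "(\<psi> \<circ> \<phi>) x = left x" if "x \<in> S" for x
    using pres_gen_eqI[OF group_B hom left_hom gens that] .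
  \<comment> \<open>The composite is the faithful regular action, and the inner map of an injective
    composite is injective.\<close>
  then have "inj_on (\<psi> \<circ> \<phi>) S"
    using inj_left by (simp cong: inj_on_cong)
  then have "inj_on \<phi> S"
    by (rule inj_on_imageI2)
  then show ?thesis
    using assms(2) by (auto simp: mon_def dest: inj_onD)
qed

end
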